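(* Let $\mu,\alpha\in\mathbb{R}$ with $\alpha\neq0$, and write $\boldsymbol q=(x,y,z,E,B)^T\in\mathbb{R}^5$. Consider the system $$\dot x=-y,\quad \dot y=x+zE,\quad \dot z=-yE,\quad \dot E=B,\quad \dot B=\alpha x-\mu^2E,$$ and put $$H(\boldsymbol q)=\alpha z-\alpha xE+\tfrac12\mu^2E^2+\tfrac12B^2,\qquad F(\boldsymbol q)=x^2+y^2+z^2,$$ $$\boldsymbol J(\boldsymbol q)=\frac1\alpha\begin{bmatrix} 0 & z & -y & 0 & 0 \\ -z & 0 & x & 0 & 0 \\ y & -x & 0 & 0 & 0 \\ 0 & 0 & 0 & 0 & \alpha \\ 0 & 0 & 0 & -\alpha & 0 \end{bmatrix}.$$ Then the bracket $\{f,g\}=(\nabla f)^T\boldsymbol J(\boldsymbol q)\nabla g$ is a degenerate Poisson bracket on $\mathbb{R}^5$, the function $F$ is a Casimir of this bracket, and the system is Hamiltonian with respect to it with Hamiltonian function $H$, i.e. it coincides with $\dot{\boldsymbol q}=\boldsymbol J(\boldsymbol q)\nabla H(\boldsymbol q)$.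
   Context: A Poisson bracket on $\mathbb{R}^5$ is a bilinear, antisymmetric bracket on smooth functions that satisfies the Leibniz rule and the Jacobi identity. It is called degenerate if its structure matrix $\boldsymbol J(\boldsymbol q)$ is singular. A Casimir is a non-constant function $F$ with $\{F,g\}=0$ for every smooth $g$. Gradients $\nabla f$ are column vectors of partial derivatives with respect to $(x,y,z,E,B)$. *)

theory Defs
  imports "HOL-Analysis.Analysis"
begin

definition partial_deriv :: "'n::finite \<Rightarrow> (real^'n \<Rightarrow> real) \<Rightarrow> real^'n \<Rightarrow> real" where
  "partial_deriv i f q = deriv (\<lambda>t. f (q + t *\<^sub>R axis i 1)) 0"

definition gradient :: "(real^'n::finite \<Rightarrow> real) \<Rightarrow> real^'n \<Rightarrow> real^'n" where
  "gradient f q = (\<chi> i. partial_deriv i f q)"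

text \<open>\<open>Ck_fun k f\<close> says that \<open>f\<close> is of class \<open>C\<^sup>k\<close> on the whole space. Total differentiability
  in the successor case guarantees that the partial derivatives taken there exist (\<open>deriv\<close> is
  a total operator); it is implied by continuity of the partial derivatives, so the notion is
  the usual one.\<close>

primrec Ck_fun :: "nat \<Rightarrow> (real^'n::finite \<Rightarrow> real) \<Rightarrow> bool" where
  "Ck_fun 0 f \<longleftrightarrow> continuous_on UNIV f"
| "Ck_fun (Suc k) f \<longleftrightarrow> f differentiable_on UNIV \<and> (\<forall>i. Ck_fun k (partial_deriv i f))"

definition smooth_fun :: "(real^'n::finite \<Rightarrow> real) \<Rightarrow> bool" where
  "smooth_fun f \<longleftrightarrow> (\<forall>k. Ck_fun k f)"

type_synonym 'n bracket = "(real^'n \<Rightarrow> real) \<Rightarrow> (real^'n \<Rightarrow> real) \<Rightarrow> (real^'n \<Rightarrow> real)"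

text \<open>A bracket is a total operation on all real functions, but only its values on smooth
  functions matter.\<close>

definition poisson_bracket :: "'n::finite bracket \<Rightarrow> bool" where
  "poisson_bracket br \<longleftrightarrow>
     (\<forall>f g. smooth_fun f \<longrightarrow> smooth_fun g \<longrightarrow> smooth_fun (br f g)) \<and>
     (\<forall>a b f g h. smooth_fun f \<longrightarrow> smooth_fun g \<longrightarrow> smooth_fun h \<longrightarrow>
        br (\<lambda>q. a * f q + b * g q) h = (\<lambda>q. a * br f h q + b * br g h q)) \<and>
     (\<forall>a b f g h. smooth_fun f \<longrightarrow> smooth_fun g \<longrightarrow> smooth_fun h \<longrightarrow>
        br h (\<lambda>q. a * f q + b * g q) = (\<lambda>q. a * br h f q + b * br h g q)) \<and>
     (\<forall>f g. smooth_fun f \<longrightarrow> smooth_fun g \<longrightarrow> br f g = (\<lambda>q. - br g f q)) \<and>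
     (\<forall>f g h. smooth_fun f \<longrightarrow> smooth_fun g \<longrightarrow> smooth_fun h \<longrightarrow>
        br (\<lambda>q. f q * g q) h = (\<lambda>q. f q * br g h q + br f h q * g q)) \<and>
     (\<forall>f g h. smooth_fun f \<longrightarrow> smooth_fun g \<longrightarrow> smooth_fun h \<longrightarrow>
        (\<forall>q. br f (br g h) q + br g (br h f) q + br h (br f g) q = 0))"

definition structure_matrix :: "'n::finite bracket \<Rightarrow> real^'n \<Rightarrow> real^'n^'n" where
  "structure_matrix br q = (\<chi> i j. br (\<lambda>p. p $ i) (\<lambda>p. p $ j) q)"

definition degenerate_bracket :: "'n::finite bracket \<Rightarrow> bool" where
  "degenerate_bracket br \<longleftrightarrow> (\<forall>q. det (structure_matrix br q) = 0)"

definition casimir :: "'n::finite bracket \<Rightarrow> (real^'n \<Rightarrow> real) \<Rightarrow> bool" where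
  "casimir br C \<longleftrightarrow> smooth_fun C \<and> \<not> C constant_on UNIV \<and>
     (\<forall>g. smooth_fun g \<longrightarrow> br C g = (\<lambda>q. 0))"

definition matrix_bracket :: "(real^'n \<Rightarrow> real^'n^'n) \<Rightarrow> 'n::finite bracket" where
  "matrix_bracket J f g q = gradient f q \<bullet> (J q *v gradient g q)"

text \<open>The matrix used to build a bracket is its structure matrix.\<close>

lemma partial_deriv_coordinate: "partial_deriv i (\<lambda>p. p $ j) q = (if i = j then 1 else 0)"
proof -
  have "((\<lambda>t. (q + t *\<^sub>R axis i 1) $ j) has_field_derivative (if i = j then 1 else 0)) (at 0)"
    by (auto simp: axis_def intro!: derivative_eq_intros)
  then show ?thesis
    unfolding partial_deriv_def by (rule DERIV_imp_deriv)
qed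

lemma gradient_coordinate: "gradient (\<lambda>p. p $ j) q = axis j 1"
  by (simp add: gradient_def partial_deriv_coordinate vec_eq_iff axis_def)

lemma structure_matrix_matrix_bracket: "structure_matrix (matrix_bracket J) = J"
  by (rule ext)
    (simp add: structure_matrix_def matrix_bracket_def gradient_coordinate vec_eq_iff
      inner_axis' matrix_vector_mul_component inner_axis)

text \<open>The coordinates \<open>(x, y, z, E, B)\<close> of \<open>q\<close> are \<open>q $ 1, \<dots>, q $ 5\<close>. In the index type \<open>5\<close>
  the numeral \<open>5\<close> equals \<open>0\<close>; the five indices are distinct, and \<open>vector\<close> lists entries in the
  order \<open>1, \<dots>, 5\<close>.\<close>

definition system_field :: "real \<Rightarrow> real \<Rightarrow> real^5 \<Rightarrow> real^5" where
  "system_field \<mu> \<alpha> q =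
    (let x = q $ 1; y = q $ 2; z = q $ 3; E = q $ 4; B = q $ 5 in
     vector [- y, x + z * E, - y * E, B, \<alpha> * x - \<mu>\<^sup>2 * E])"

definition hamiltonian_H :: "real \<Rightarrow> real \<Rightarrow> real^5 \<Rightarrow> real" where
  "hamiltonian_H \<mu> \<alpha> q =
    (let x = q $ 1; y = q $ 2; z = q $ 3; E = q $ 4; B = q $ 5 in
     \<alpha> * z - \<alpha> * x * E + 1/2 * \<mu>\<^sup>2 * E\<^sup>2 + 1/2 * B\<^sup>2)"

definition casimir_F :: "real^5 \<Rightarrow> real" where
  "casimir_F q = (q $ 1)\<^sup>2 + (q $ 2)\<^sup>2 + (q $ 3)\<^sup>2"

definition matrix_J :: "real \<Rightarrow> real^5 \<Rightarrow> real^5^5" where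
  "matrix_J \<alpha> q =
    (let x = q $ 1; y = q $ 2; z = q $ 3 in
     (1 / \<alpha>) *\<^sub>R vector [
       vector [  0,   z, - y,   0, 0],
       vector [- z,   0,   x,   0, 0],
       vector [  y, - x,   0,   0, 0],
       vector [  0,   0,   0,   0, \<alpha>],
       vector [  0,   0,   0, - \<alpha>, 0]])"

end

theory Submission
  imports Defs
begin

section \<open>Partial derivatives and functions of class \<open>C\<^sup>k\<close>\<close>

text \<open>The matrix splits into two blocks. On (x, y, z) it is the Lie-Poisson structure of so(3)
  scaled by 1/\<alpha>, with {x, y} = z/\<alpha>, {y, z} = x/\<alpha>, {z, x} = y/\<alpha>; on (E,
  B) it is the constant canonical symplectic block.

  A bracket built from an antisymmetric matrix with smooth entries is closed on smooth functions,
  bilinear, antisymmetric and Leibniz by the product rule. For the Jacobi identity, the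
  second-derivative terms of the cyclic sum cancel because Hessians are symmetric
  (\<open>partial_deriv_commute\<close>), so the identity reduces to its instances on coordinate
  functions (\<open>poisson_bracket_matrix_bracket\<close>). For this matrix those instances are a
  finite check (\<open>matrix_J_jacobi\<close>).

  Degeneracy is forced by parity: an antisymmetric matrix of odd size has determinant zero
  (\<open>det_antisym_odd\<close>). The (x, y, z) block sends v to the cross product of v with (x,
  y, z), divided by \<alpha>. It therefore kills the gradient of F, which is 2(x, y, z), and this
  makes F a Casimir. The equations of motion follow by multiplying the matrix by the gradient of
  H.\<close>

lemma has_real_derivative_line_partial_deriv:
  fixes f :: "real^'n::finite \<Rightarrow> real"
  assumes "f differentiable_on UNIV"
  shows "((\<lambda>t. f (q + t *\<^sub>R axis i 1)) has_real_derivative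
    partial_deriv i f (q + s *\<^sub>R axis i 1)) (at s)"
proof -
  \<comment> \<open>The chain rule through the total derivative covers every point of the line, as
    the mean value theorem later requires; the point s = 0 then identifies the value with
    \<open>partial_deriv\<close>.\<close>
  have line: "((\<lambda>t. f (q + t *\<^sub>R axis i 1)) has_real_derivative
      frechet_derivative f (at (q + s *\<^sub>R axis i 1)) (axis i 1)) (at s)" for q s
  proof -
    let ?D = "frechet_derivative f (at (q + s *\<^sub>R axis i 1))"
    have D: "(f has_derivative ?D) (at (q + s *\<^sub>R axis i 1))"
      using assms by (metis UNIV_I differentiable_on_def frechet_derivative_works)
    have "((\<lambda>t. q + t *\<^sub>R axis i 1) has_derivative (\<lambda>t. t *\<^sub>R axis i 1)) (at s)"
      by (auto intro!: derivative_eq_intros)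
    from has_derivative_compose[OF this D]
    have "((\<lambda>t. f (q + t *\<^sub>R axis i 1)) has_derivative (\<lambda>t. ?D (t *\<^sub>R axis i 1))) (at s)" .
    moreover have "?D (t *\<^sub>R axis i 1) = ?D (axis i 1) * t" for t
      using linear_scale[OF has_derivative_linear[OF D]] by simp
    ultimately show ?thesis
      by (simp add: has_field_derivative_def)
  qed
  have "partial_deriv i f p = frechet_derivative f (at p) (axis i 1)" for p
    using line[of p 0] by (auto simp: partial_deriv_def intro: DERIV_imp_deriv)
  then show ?thesis
    using line by simp
qed

lemma has_real_derivative_partial_deriv:
  fixes f :: "real^'n::finite \<Rightarrow> real"
  assumes "f differentiable_on UNIV"
  shows "((\<lambda>t. f (q + t *\<^sub>R axis i 1)) has_real_derivative partial_deriv i f q) (at 0)"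
  using has_real_derivative_line_partial_deriv[OF assms, of q i 0] by simp

lemma partial_deriv_const: "partial_deriv i (\<lambda>q. c) = (\<lambda>q. 0)"
  by (simp add: partial_deriv_def fun_eq_iff)

lemma partial_deriv_add:
  fixes f g :: "real^'n::finite \<Rightarrow> real"
  assumes "f differentiable_on UNIV" "g differentiable_on UNIV"
  shows "partial_deriv i (\<lambda>q. f q + g q) = (\<lambda>q. partial_deriv i f q + partial_deriv i g q)"
  unfolding partial_deriv_def[of i "\<lambda>q. f q + g q"]
  by (intro ext DERIV_imp_deriv DERIV_add has_real_derivative_partial_deriv assms)

lemma partial_deriv_mult:
  fixes f g :: "real^'n::finite \<Rightarrow> real"
  assumes "f differentiable_on UNIV" "g differentiable_on UNIV"
  shows "partial_deriv i (\<lambda>q. f q * g q) =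
    (\<lambda>q. f q * partial_deriv i g q + partial_deriv i f q * g q)"
proof
  fix q
  show "partial_deriv i (\<lambda>q. f q * g q) q = f q * partial_deriv i g q + partial_deriv i f q * g q"
    unfolding partial_deriv_def[of i "\<lambda>q. f q * g q"]
    using DERIV_mult[OF has_real_derivative_partial_deriv[OF assms(1), of q i]
        has_real_derivative_partial_deriv[OF assms(2), of q i]]
    by (intro DERIV_imp_deriv) (simp add: algebra_simps)
qed

lemma partial_deriv_sum:
  fixes f :: "'a \<Rightarrow> real^'n::finite \<Rightarrow> real"
  assumes "\<And>a. a \<in> A \<Longrightarrow> f a differentiable_on UNIV"
  shows "partial_deriv i (\<lambda>q. \<Sum>a\<in>A. f a q) = (\<lambda>q. \<Sum>a\<in>A. partial_deriv i (f a) q)"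
  unfolding partial_deriv_def[of i "\<lambda>q. \<Sum>a\<in>A. f a q"]
  by (intro ext DERIV_imp_deriv DERIV_sum has_real_derivative_partial_deriv assms)

section \<open>Closure properties of C^k and smooth functions\<close>

lemma Ck_fun_SucD: "Ck_fun (Suc k) f \<Longrightarrow> Ck_fun k f"
  by (induction k arbitrary: f) (auto intro: differentiable_imp_continuous_on)

lemma Ck_fun_const: "Ck_fun k (\<lambda>q. c)"
  by (induction k arbitrary: c) (simp_all add: partial_deriv_const)

lemma Ck_fun_add: "Ck_fun k f \<Longrightarrow> Ck_fun k g \<Longrightarrow> Ck_fun k (\<lambda>q. f q + g q)"
  by (induction k arbitrary: f g)
    (auto simp: partial_deriv_add intro: continuous_on_add differentiable_on_add)

lemma Ck_fun_mult: "Ck_fun k f \<Longrightarrow> Ck_fun k g \<Longrightarrow> Ck_fun k (\<lambda>q. f q * g q)"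
proof (induction k arbitrary: f g)
  case 0
  then show ?case by (auto intro: continuous_on_mult)
next
  case (Suc k)
  \<comment> \<open>The product rule leaves one factor undifferentiated in each term, so the
    induction hypothesis needs f and g themselves at level k.\<close>
  have "Ck_fun k f" "Ck_fun k g"
    using Suc.prems by (blast dest: Ck_fun_SucD)+
  with Suc show ?case
    by (auto simp: partial_deriv_mult intro!: differentiable_on_mult Ck_fun_add simp del: Ck_fun.simps(1))
qed

lemma smooth_fun_differentiable: "smooth_fun f \<Longrightarrow> f differentiable_on UNIV"
  unfolding smooth_fun_def by (metis Ck_fun.simps(2))

lemma smooth_fun_partial_deriv: "smooth_fun f \<Longrightarrow> smooth_fun (partial_deriv i f)"
  unfolding smooth_fun_def by (metis Ck_fun.simps(2))

lemma smooth_fun_const: "smooth_fun (\<lambda>q. c)"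
  by (simp add: smooth_fun_def Ck_fun_const)

lemma smooth_fun_add: "smooth_fun f \<Longrightarrow> smooth_fun g \<Longrightarrow> smooth_fun (\<lambda>q. f q + g q)"
  by (simp add: smooth_fun_def Ck_fun_add)

lemma smooth_fun_mult: "smooth_fun f \<Longrightarrow> smooth_fun g \<Longrightarrow> smooth_fun (\<lambda>q. f q * g q)"
  by (simp add: smooth_fun_def Ck_fun_mult)

lemma smooth_fun_uminus: "smooth_fun f \<Longrightarrow> smooth_fun (\<lambda>q. - f q)"
  using smooth_fun_mult[OF smooth_fun_const[of "-1"]] by simp

lemma smooth_fun_diff: "smooth_fun f \<Longrightarrow> smooth_fun g \<Longrightarrow> smooth_fun (\<lambda>q. f q - g q)"
  using smooth_fun_add[OF _ smooth_fun_uminus] by simp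

lemma smooth_fun_power2: "smooth_fun f \<Longrightarrow> smooth_fun (\<lambda>q. (f q)\<^sup>2)"
  by (simp add: power2_eq_square smooth_fun_mult)

lemma smooth_fun_sum:
  "(\<And>a. a \<in> A \<Longrightarrow> smooth_fun (f a)) \<Longrightarrow> smooth_fun (\<lambda>q. \<Sum>a\<in>A. f a q)"
  by (induction A rule: infinite_finite_induct) (auto intro: smooth_fun_const smooth_fun_add)

lemma smooth_fun_coordinate: "smooth_fun (\<lambda>q::real^'n::finite. q $ j)"
proof -
  have pd: "partial_deriv i (\<lambda>q. q $ j) = (\<lambda>q. if i = j then 1 else 0)" for i :: 'n
    by (rule ext) (rule partial_deriv_coordinate)
  have "(\<lambda>q. q $ j) differentiable_on UNIV"
    by (intro bounded_linear_imp_differentiable_on bounded_linear_vec_nth)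
  then have "Ck_fun k (\<lambda>q. q $ j)" for k
    by (cases k) (auto simp: pd Ck_fun_const intro: differentiable_imp_continuous_on)
  then show ?thesis
    by (simp add: smooth_fun_def)
qed

lemmas smooth_fun_intros =
  smooth_fun_const smooth_fun_add smooth_fun_mult smooth_fun_uminus smooth_fun_diff
  smooth_fun_power2 smooth_fun_sum smooth_fun_coordinate smooth_fun_partial_deriv

lemma partial_deriv_cmult:
  assumes "f differentiable_on UNIV"
  shows "partial_deriv i (\<lambda>q. c * f q) = (\<lambda>q. c * partial_deriv i f q)"
  using partial_deriv_mult[OF smooth_fun_differentiable[OF smooth_fun_const[of c]] assms]
  by (simp add: partial_deriv_const)

section \<open>Symmetry of second partial derivatives\<close>

text \<open>Two applications of the mean value theorem express the mixed second difference of \<open>f\<close> over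
  a square with side \<open>h\<close>, which is symmetric in \<open>i\<close> and \<open>j\<close>, by a mixed derivative.\<close>

lemma second_difference_eq_partial_deriv:
  fixes f :: "real^'n::finite \<Rightarrow> real"
  assumes f: "Ck_fun 2 f" and h: "0 < h"
  obtains p where "norm (p - q) \<le> 2 * h"
    "f (q + h *\<^sub>R axis i 1 + h *\<^sub>R axis j 1) - f (q + h *\<^sub>R axis i 1) - f (q + h *\<^sub>R axis j 1) + f q
      = h * h * partial_deriv j (partial_deriv i f) p"
proof -
  let ?u = "axis i 1 :: real^'n" and ?v = "axis j 1 :: real^'n"
  have d: "f differentiable_on UNIV" "partial_deriv i f differentiable_on UNIV"
    using f by (auto simp: numeral_2_eq_2)
  \<comment> \<open>The increment of \<phi> from 0 to h is the mixed second difference; the first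
    mean value step acts along axis i, the second along axis j.\<close>
  define \<phi> where "\<phi> s = f ((q + h *\<^sub>R ?v) + s *\<^sub>R ?u) - f (q + s *\<^sub>R ?u)" for s
  have "(\<phi> has_real_derivative partial_deriv i f ((q + h *\<^sub>R ?v) + s *\<^sub>R ?u)
      - partial_deriv i f (q + s *\<^sub>R ?u)) (at s)" for s
    unfolding \<phi>_def by (intro DERIV_diff has_real_derivative_line_partial_deriv d)
  from MVT2[OF h this] obtain s where s: "0 < s" "s < h"
    "\<phi> h - \<phi> 0 = (h - 0) * (partial_deriv i f ((q + h *\<^sub>R ?v) + s *\<^sub>R ?u)
      - partial_deriv i f (q + s *\<^sub>R ?u))" by blast
  from MVT2[OF h has_real_derivative_line_partial_deriv[OF d(2), of "q + s *\<^sub>R ?u" j]]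
  obtain t where t: "0 < t" "t < h"
    "partial_deriv i f ((q + s *\<^sub>R ?u) + h *\<^sub>R ?v) - partial_deriv i f (q + s *\<^sub>R ?u)
      = h * partial_deriv j (partial_deriv i f) ((q + s *\<^sub>R ?u) + t *\<^sub>R ?v)"
    by auto
  show thesis
  proof (rule that)
    have "norm (s *\<^sub>R ?u + t *\<^sub>R ?v) \<le> s + t"
      using norm_triangle_ineq[of "s *\<^sub>R ?u" "t *\<^sub>R ?v"] s t by simp
    then show "norm (((q + s *\<^sub>R ?u) + t *\<^sub>R ?v) - q) \<le> 2 * h"
      using s t by (simp add: add.assoc)
    show "f (q + h *\<^sub>R ?u + h *\<^sub>R ?v) - f (q + h *\<^sub>R ?u) - f (q + h *\<^sub>R ?v) + f q
      = h * h * partial_deriv j (partial_deriv i f) ((q + s *\<^sub>R ?u) + t *\<^sub>R ?v)"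
      using s(3) t(3) by (simp add: \<phi>_def algebra_simps)
  qed
qed

text \<open>One and the same second difference, divided by h * h, is a value of either mixed
  derivative at a point within 2 * h of q. Letting h shrink, continuity identifies both values at
  q.\<close>

lemma partial_deriv_commute:
  fixes f :: "real^'n::finite \<Rightarrow> real"
  assumes f: "Ck_fun 2 f"
  shows "partial_deriv i (partial_deriv j f) q = partial_deriv j (partial_deriv i f) q"
proof -
  let ?A = "partial_deriv i (partial_deriv j f)" and ?B = "partial_deriv j (partial_deriv i f)"
  have cont: "isCont ?A q" "isCont ?B q"
    using f by (auto simp: numeral_2_eq_2 continuous_on_eq_continuous_at)
  have "dist (?A q) (?B q) < e" if e: "0 < e" for e
  proof -
    have "0 < e / 2" using e by simp
    then obtain d1 d2 where d: "0 < d1" "0 < d2"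
      "\<And>p. dist p q < d1 \<Longrightarrow> dist (?A p) (?A q) < e / 2"
      "\<And>p. dist p q < d2 \<Longrightarrow> dist (?B p) (?B q) < e / 2"
      using cont unfolding continuous_at_eps_delta by metis
    \<comment> \<open>A third of the smaller radius puts the points at distance at most 2 * h inside
      both continuity neighbourhoods.\<close>
    define h where "h = min d1 d2 / 3"
    have h: "0 < h" "2 * h < d1" "2 * h < d2"
      using d(1,2) by (auto simp: h_def min_def)
    obtain p1 where p1: "norm (p1 - q) \<le> 2 * h"
      "f (q + h *\<^sub>R axis i 1 + h *\<^sub>R axis j 1) - f (q + h *\<^sub>R axis i 1) - f (q + h *\<^sub>R axis j 1) + f q
        = h * h * ?B p1"
      by (rule second_difference_eq_partial_deriv[OF f h(1)])
    obtain p2 where p2: "norm (p2 - q) \<le> 2 * h"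
      "f (q + h *\<^sub>R axis j 1 + h *\<^sub>R axis i 1) - f (q + h *\<^sub>R axis j 1) - f (q + h *\<^sub>R axis i 1) + f q
        = h * h * ?A p2"
      by (rule second_difference_eq_partial_deriv[OF f h(1)])
    have "h * h * ?B p1 = h * h * ?A p2"
      using p1(2) p2(2) by (simp add: algebra_simps)
    then have "?A p2 = ?B p1"
      using h by simp
    moreover have "dist (?A p2) (?A q) < e / 2" "dist (?B p1) (?B q) < e / 2"
      using d(3)[of p2] d(4)[of p1] p1(1) p2(1) h by (auto simp: dist_norm)
    ultimately show ?thesis
      by (metis dist_triangle_half_r)
  qed
  then show ?thesis
    by (metis dist_pos_lt less_irrefl)
qed

section \<open>Poisson brackets given by a matrix\<close>

lemma matrix_bracket_sum:
  "matrix_bracket J f g =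
    (\<lambda>q. \<Sum>i\<in>UNIV. \<Sum>j\<in>UNIV. J q $ i $ j * (partial_deriv i f q * partial_deriv j g q))"
  by (simp add: fun_eq_iff matrix_bracket_def gradient_def inner_vec_def
      matrix_vector_mult_def sum_distrib_left algebra_simps)

lemma sum_rotate:
  "(\<Sum>i\<in>A. \<Sum>j\<in>B. \<Sum>k\<in>C. F i j k) = (\<Sum>k\<in>C. \<Sum>i\<in>A. \<Sum>j\<in>B. F i j k)"
proof -
  have "(\<Sum>i\<in>A. \<Sum>j\<in>B. \<Sum>k\<in>C. F i j k) = (\<Sum>i\<in>A. \<Sum>k\<in>C. \<Sum>j\<in>B. F i j k)"
    by (intro sum.cong refl) (rule sum.swap)
  also have "\<dots> = (\<Sum>k\<in>C. \<Sum>i\<in>A. \<Sum>j\<in>B. F i j k)"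
    by (rule sum.swap)
  finally show ?thesis .
qed

lemma matrix_bracket_antisym:
  assumes "\<And>q i j. J q $ i $ j = - J q $ j $ i"
  shows "matrix_bracket J f g q = - matrix_bracket J g f q"
proof -
  have "matrix_bracket J f g q
      = (\<Sum>j\<in>UNIV. \<Sum>i\<in>UNIV. J q $ i $ j * (partial_deriv i f q * partial_deriv j g q))"
    unfolding matrix_bracket_sum by (rule sum.swap)
  also have "\<dots> = (\<Sum>j\<in>UNIV. \<Sum>i\<in>UNIV. - (J q $ j $ i * (partial_deriv j g q * partial_deriv i f q)))"
    by (intro sum.cong refl, subst assms) simp
  finally show ?thesis
    by (simp add: matrix_bracket_sum sum_negf)
qed

text \<open>Expanding \<open>{f, {g, h}}\<close> gives a first-order term that is trilinear in the gradients, and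
  two terms with second derivatives. By the symmetry of second derivatives the latter cancel
  in the cyclic sum.\<close>

lemma poisson_bracket_matrix_bracket:
  fixes J :: "real^'n::finite \<Rightarrow> real^'n^'n"
  assumes smooth: "\<And>i j. smooth_fun (\<lambda>q. J q $ i $ j)"
    and antisym: "\<And>q i j. J q $ i $ j = - J q $ j $ i"
    and jacobi: "\<And>q i j k. (\<Sum>l\<in>UNIV. J q $ i $ l * partial_deriv l (\<lambda>p. J p $ j $ k) q
      + J q $ j $ l * partial_deriv l (\<lambda>p. J p $ k $ i) q
      + J q $ k $ l * partial_deriv l (\<lambda>p. J p $ i $ j) q) = 0"
  shows "poisson_bracket (matrix_bracket J)"
proof -
  let ?P = "\<lambda>f i q. partial_deriv i f q"
  have sm: "smooth_fun (matrix_bracket J f g)" if "smooth_fun f" "smooth_fun g" for f g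
    unfolding matrix_bracket_sum by (intro smooth_fun_intros smooth that)
  have lin: "matrix_bracket J (\<lambda>q. a * f q + b * g q) h
      = (\<lambda>q. a * matrix_bracket J f h q + b * matrix_bracket J g h q)"
    if "smooth_fun f" "smooth_fun g" for a b f g h
  proof -
    have "?P (\<lambda>q. a * f q + b * g q) i q = a * ?P f i q + b * ?P g i q" for i q
      using that by (simp add: partial_deriv_add partial_deriv_cmult smooth_fun_differentiable
          smooth_fun_mult smooth_fun_const)
    then show ?thesis
      by (simp add: matrix_bracket_sum fun_eq_iff sum_distrib_left sum.distrib algebra_simps)
  qed
  have anti: "matrix_bracket J f g q = - matrix_bracket J g f q" for f g q
    by (rule matrix_bracket_antisym[OF antisym])
  have leibniz: "matrix_bracket J (\<lambda>q. f q * g q) h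
      = (\<lambda>q. f q * matrix_bracket J g h q + matrix_bracket J f h q * g q)"
    if "smooth_fun f" "smooth_fun g" for f g h
    using that
    by (simp add: matrix_bracket_sum fun_eq_iff partial_deriv_mult smooth_fun_differentiable
        sum_distrib_left sum_distrib_right sum.distrib algebra_simps)
  have jac: "matrix_bracket J f (matrix_bracket J g h) q
      + matrix_bracket J g (matrix_bracket J h f) q
      + matrix_bracket J h (matrix_bracket J f g) q = 0"
    if f: "smooth_fun f" and g: "smooth_fun g" and h: "smooth_fun h" for f g h q
  proof -
    \<comment> \<open>X u is the vector J grad u, D i j k is the bracket of coordinate i with the
      entry \<open>J $ j $ k\<close>, S is the trilinear form with coefficients D, and Q u v w is
      the Hessian of v evaluated on X u and X w.\<close>
    define X where "X u i = (\<Sum>j\<in>UNIV. J q $ i $ j * ?P u j q)" for u i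
    define D where "D i j k = (\<Sum>l\<in>UNIV. J q $ i $ l * ?P (\<lambda>p. J p $ j $ k) l q)" for i j k
    define S where "S u v w
      = (\<Sum>i\<in>UNIV. \<Sum>j\<in>UNIV. \<Sum>k\<in>UNIV. D i j k * (?P u i q * (?P v j q * ?P w k q)))" for u v w
    define Q where "Q u v w = (\<Sum>l\<in>UNIV. \<Sum>j\<in>UNIV. X u l * (?P (?P v j) l q * X w j))" for u v w
    have X_swap: "(\<Sum>j\<in>UNIV. J q $ j $ i * ?P u j q) = - X u i" for u i
      unfolding X_def sum_negf[symmetric] by (intro sum.cong refl, subst antisym) simp
    have Q_sym: "Q u v w = Q w v u" if "smooth_fun v" for u v w
    proof -
      have c: "Ck_fun 2 v"
        using that by (simp add: smooth_fun_def)
      have "Q u v w = (\<Sum>j\<in>UNIV. \<Sum>l\<in>UNIV. X u l * (?P (?P v j) l q * X w j))"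
        unfolding Q_def by (rule sum.swap)
      also have "\<dots> = Q w v u"
        unfolding Q_def
        by (intro sum.cong refl) (simp add: partial_deriv_commute[OF c] mult_ac)
      finally show ?thesis .
    qed
    have pd: "?P (matrix_bracket J v w) l q
        = (\<Sum>j\<in>UNIV. \<Sum>k\<in>UNIV. ?P (\<lambda>p. J p $ j $ k) l q * (?P v j q * ?P w k q))
          + (\<Sum>j\<in>UNIV. ?P (?P v j) l q * X w j) - (\<Sum>j\<in>UNIV. ?P (?P w j) l q * X v j)"
      if v: "smooth_fun v" and w: "smooth_fun w" for v w l
    proof -
      have "?P (matrix_bracket J v w) l q = (\<Sum>j\<in>UNIV. \<Sum>k\<in>UNIV.
          ?P (\<lambda>p. J p $ j $ k) l q * (?P v j q * ?P w k q)
          + ?P (?P v j) l q * (J q $ j $ k * ?P w k q)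
          + ?P (?P w k) l q * (J q $ j $ k * ?P v j q))"
        unfolding matrix_bracket_sum
        by (simp add: partial_deriv_sum partial_deriv_mult smooth_fun_differentiable
            smooth_fun_intros smooth v w algebra_simps)
      also have "\<dots> = (\<Sum>j\<in>UNIV. \<Sum>k\<in>UNIV. ?P (\<lambda>p. J p $ j $ k) l q * (?P v j q * ?P w k q))
          + (\<Sum>j\<in>UNIV. \<Sum>k\<in>UNIV. ?P (?P v j) l q * (J q $ j $ k * ?P w k q))
          + (\<Sum>k\<in>UNIV. \<Sum>j\<in>UNIV. ?P (?P w k) l q * (J q $ j $ k * ?P v j q))"
        \<comment> \<open>In the last sum the Hessian of w carries the index k, so j must become the
          inner index before \<open>X_swap\<close> can contract it to - X v k.\<close>
        by (subst (3) sum.swap) (simp add: sum.distrib)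
      finally show ?thesis
        by (simp add: sum_distrib_left[symmetric] X_swap sum_negf X_def[symmetric])
    qed
    have double: "matrix_bracket J u (matrix_bracket J v w) q = S u v w - Q u v w + Q u w v"
      if v: "smooth_fun v" and w: "smooth_fun w" for u v w
    proof -
      have "matrix_bracket J u (matrix_bracket J v w) q
          = (\<Sum>l\<in>UNIV. \<Sum>i\<in>UNIV. ?P (matrix_bracket J v w) l q * (J q $ i $ l * ?P u i q))"
        by (subst sum.swap) (simp add: matrix_bracket_sum[of J u] mult_ac)
      also have "\<dots> = (\<Sum>l\<in>UNIV. - (X u l) * ?P (matrix_bracket J v w) l q)"
        by (simp add: sum_distrib_left[symmetric] X_swap mult.commute[of "X u _"])
      also have "\<dots> = (\<Sum>l\<in>UNIV. \<Sum>j\<in>UNIV. \<Sum>k\<in>UNIV.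
            - (X u l) * (?P (\<lambda>p. J p $ j $ k) l q * (?P v j q * ?P w k q)))
          - Q u v w + Q u w v"
        by (simp add: pd[OF v w] Q_def sum_distrib_left sum.distrib sum_subtractf sum_negf
            algebra_simps)
      also have "(\<Sum>l\<in>UNIV. \<Sum>j\<in>UNIV. \<Sum>k\<in>UNIV.
            - (X u l) * (?P (\<lambda>p. J p $ j $ k) l q * (?P v j q * ?P w k q)))
          = (\<Sum>j\<in>UNIV. \<Sum>k\<in>UNIV. \<Sum>l\<in>UNIV. \<Sum>i\<in>UNIV.
            J q $ i $ l * ?P u i q * (?P (\<lambda>p. J p $ j $ k) l q * (?P v j q * ?P w k q)))"
        by (subst sum_rotate[symmetric]) (simp add: X_swap[symmetric] sum_distrib_right)
      also have "\<dots> = (\<Sum>j\<in>UNIV. \<Sum>k\<in>UNIV. \<Sum>i\<in>UNIV. \<Sum>l\<in>UNIV.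
            J q $ i $ l * ?P u i q * (?P (\<lambda>p. J p $ j $ k) l q * (?P v j q * ?P w k q)))"
        by (rule sum.cong[OF refl], rule sum.cong[OF refl], rule sum.swap)
      also have "\<dots> = (\<Sum>i\<in>UNIV. \<Sum>j\<in>UNIV. \<Sum>k\<in>UNIV. \<Sum>l\<in>UNIV.
            J q $ i $ l * ?P u i q * (?P (\<lambda>p. J p $ j $ k) l q * (?P v j q * ?P w k q)))"
        by (rule sum_rotate)
      also have "\<dots> = S u v w"
        unfolding S_def D_def sum_distrib_right
        by (intro sum.cong refl) simp
      finally show ?thesis .
    qed
    \<comment> \<open>Indices are renamed cyclically so that all three forms share the monomial in
      the derivatives of f, g, h; the coefficients then add up to the Jacobi sum of D.\<close>
    have S1: "S g h f = (\<Sum>i\<in>UNIV. \<Sum>j\<in>UNIV. \<Sum>k\<in>UNIV. D j k i * (?P f i q * (?P g j q * ?P h k q)))"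
      unfolding S_def by (subst sum_rotate) (simp add: mult_ac)
    have S2: "S h f g = (\<Sum>i\<in>UNIV. \<Sum>j\<in>UNIV. \<Sum>k\<in>UNIV. D k i j * (?P f i q * (?P g j q * ?P h k q)))"
      unfolding S_def by (subst sum_rotate[symmetric]) (simp add: mult_ac)
    have "D i j k + D j k i + D k i j = 0" for i j k
      using jacobi[of q i j k] by (simp add: D_def sum.distrib)
    then have "S f g h + S g h f + S h f g = 0"
      unfolding S1 S2 unfolding S_def by (simp flip: sum.distrib distrib_right)
    \<comment> \<open>The six Q terms cancel in pairs: Q f g h with Q h g f, Q f h g with Q g h f, Q
      g f h with Q h f g.\<close>
    then show ?thesis
      using Q_sym[OF f, of g h] Q_sym[OF g, of f h] Q_sym[OF h, of f g]
      by (simp add: double f g h)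
  qed
  show ?thesis
    unfolding poisson_bracket_def
  proof (intro conjI allI impI)
    \<comment> \<open>Linearity in the second slot is carried over from the first by
      antisymmetry.\<close>
    show "matrix_bracket J h (\<lambda>q. a * f q + b * g q)
        = (\<lambda>q. a * matrix_bracket J h f q + b * matrix_bracket J h g q)"
      if "smooth_fun f" "smooth_fun g" for a b f g h
      by (rule ext) (simp add: anti[of h f] anti[of h g] anti[of h "\<lambda>q. a * f q + b * g q"] lin[OF that])
    show "matrix_bracket J f g = (\<lambda>q. - matrix_bracket J g f q)" for f g
      by (rule ext) (rule anti)
  qed (use sm lin leibniz jac in blast)+
qed

text \<open>Transposing preserves the determinant, while negating all n rows multiplies it by
  (-1)^n; for odd n this gives det A = - det A.\<close>

lemma det_antisym_odd:
  fixes A :: "real^'n^'n"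
  assumes "odd CARD('n)" and "\<And>i j. A $ i $ j = - A $ j $ i"
  shows "det A = 0"
proof -
  have "transpose A = (\<chi> i. (-1) *s A $ i)"
    by (simp add: vec_eq_iff transpose_def) (blast intro: assms(2))
  then have "det A = (-1) ^ CARD('n) * det A"
    using det_transpose[of A] det_rows_mul[of "\<lambda>i. -1" "\<lambda>i. A $ i"]
    by (simp add: vec_lambda_eta)
  then show ?thesis
    using assms(1) by simp
qed

section \<open>The system on five-dimensional space\<close>

lemma exhaust_5:
  fixes i :: 5
  shows "i = 1 \<or> i = 2 \<or> i = 3 \<or> i = 4 \<or> i = 5"
proof (induct i)
  case (of_int z)
  then have "0 \<le> z" and "z < 5" by simp_all
  \<comment> \<open>The representative z = 0 is the index written 5.\<close>
  then have "z = 0 \<or> z = 1 \<or> z = 2 \<or> z = 3 \<or> z = 4" by arith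
  then show ?case by auto
qed

lemma forall_5: "(\<forall>i::5. P i) \<longleftrightarrow> P 1 \<and> P 2 \<and> P 3 \<and> P 4 \<and> P 5"
  by (metis exhaust_5)

lemma UNIV_5: "UNIV = {1::5, 2, 3, 4, 5}"
  using exhaust_5 by auto

lemma sum_5: "sum f (UNIV::5 set) = f 1 + f 2 + f 3 + f 4 + f 5"
  unfolding UNIV_5 by (simp add: ac_simps)

lemma vector_5 [simp]:
  fixes a b c d e :: "'a::zero"
  shows "(vector [a, b, c, d, e] :: 'a^5) $ 1 = a"
    "(vector [a, b, c, d, e] :: 'a^5) $ 2 = b"
    "(vector [a, b, c, d, e] :: 'a^5) $ 3 = c"
    "(vector [a, b, c, d, e] :: 'a^5) $ 4 = d"
    "(vector [a, b, c, d, e] :: 'a^5) $ 5 = e"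
  by (simp_all add: vector_def)


section \<open>Smoothness and gradients of F and H\<close>

lemma casimir_F_smooth: "smooth_fun casimir_F"
  unfolding casimir_F_def [abs_def] by (intro smooth_fun_intros)

lemma hamiltonian_H_smooth: "smooth_fun (hamiltonian_H \<mu> \<alpha>)"
  unfolding hamiltonian_H_def [abs_def] Let_def by (intro smooth_fun_intros)

lemma gradient_casimir_F: "gradient casimir_F q = vector [2 * q $ 1, 2 * q $ 2, 2 * q $ 3, 0, 0]"
  by (simp add: vec_eq_iff forall_5 gradient_def casimir_F_def [abs_def] power2_eq_square
      partial_deriv_add partial_deriv_mult smooth_fun_differentiable smooth_fun_intros
      partial_deriv_coordinate)

lemma gradient_hamiltonian_H:
  "gradient (hamiltonian_H \<mu> \<alpha>) q =
    vector [- \<alpha> * q $ 4, 0, \<alpha>, - \<alpha> * q $ 1 + \<mu>\<^sup>2 * q $ 4, q $ 5]"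
proof -
  \<comment> \<open>The monomials of H are taken with abstract coefficients and squares written as
    products, so the sum and product rules suffice; the actual coefficients are substituted
    afterwards.\<close>
  have "gradient (\<lambda>q. a * q $ 3 + b * (q $ 1 * q $ 4) + c * (q $ 4 * q $ 4) + d * (q $ 5 * q $ 5)) q
      = vector [b * q $ 4, 0, a, b * q $ 1 + 2 * c * q $ 4, 2 * d * q $ 5]" for a b c d and q :: "real^5"
    by (simp add: vec_eq_iff forall_5 gradient_def
        partial_deriv_add partial_deriv_mult partial_deriv_const smooth_fun_differentiable
        smooth_fun_intros partial_deriv_coordinate)
  note this[of \<alpha> "- \<alpha>" "1/2 * \<mu>\<^sup>2" "1/2" q]
  moreover have "hamiltonian_H \<mu> \<alpha> = (\<lambda>q. \<alpha> * q $ 3 + (- \<alpha>) * (q $ 1 * q $ 4)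
      + (1/2 * \<mu>\<^sup>2) * (q $ 4 * q $ 4) + 1/2 * (q $ 5 * q $ 5))"
    by (simp add: fun_eq_iff hamiltonian_H_def Let_def power2_eq_square)
  ultimately show ?thesis
    by simp
qed

section \<open>Antisymmetry, smoothness and Jacobi identity of the structure matrix\<close>

text \<open>Here \<open>\<alpha> / \<alpha>\<close> is not simplified because \<open>\<alpha> = 0\<close> is allowed.\<close>

lemma matrix_J_entries:
  "matrix_J \<alpha> q $ 1 = vector [0, q $ 3 / \<alpha>, - q $ 2 / \<alpha>, 0, 0]"
  "matrix_J \<alpha> q $ 2 = vector [- q $ 3 / \<alpha>, 0, q $ 1 / \<alpha>, 0, 0]"
  "matrix_J \<alpha> q $ 3 = vector [q $ 2 / \<alpha>, - q $ 1 / \<alpha>, 0, 0, 0]"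
  "matrix_J \<alpha> q $ 4 = vector [0, 0, 0, 0, \<alpha> / \<alpha>]"
  "matrix_J \<alpha> q $ 5 = vector [0, 0, 0, - \<alpha> / \<alpha>, 0]"
  by (simp_all add: vec_eq_iff forall_5 matrix_J_def Let_def)

lemma matrix_J_antisym: "matrix_J \<alpha> q $ i $ j = - matrix_J \<alpha> q $ j $ i"
proof -
  have "\<forall>i j. matrix_J \<alpha> q $ i $ j = - matrix_J \<alpha> q $ j $ i"
    by (simp add: forall_5 matrix_J_entries)
  then show ?thesis by blast
qed

lemma matrix_J_smooth: "smooth_fun (\<lambda>q. matrix_J \<alpha> q $ i $ j)"
proof -
  have "\<forall>i j. smooth_fun (\<lambda>q. matrix_J \<alpha> q $ i $ j)"
    unfolding forall_5 matrix_J_entries vector_5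
    by (simp add: smooth_fun_intros divide_inverse)
  then show ?thesis by blast
qed

text \<open>The entries of \<open>matrix_J\<close> are affine, so a difference quotient of step 1 is exact.\<close>

lemma partial_deriv_matrix_J:
  "partial_deriv l (\<lambda>p. matrix_J \<alpha> p $ j $ k) q
    = matrix_J \<alpha> (axis l 1) $ j $ k - matrix_J \<alpha> 0 $ j $ k" (is "_ = ?d")
proof -
  have "\<forall>j k. matrix_J \<alpha> (q + t *\<^sub>R axis l 1) $ j $ k
      = matrix_J \<alpha> q $ j $ k + t * (matrix_J \<alpha> (axis l 1) $ j $ k - matrix_J \<alpha> 0 $ j $ k)" for t
    by (simp add: forall_5 matrix_J_entries add_divide_distrib diff_divide_distrib)
  then have "(\<lambda>t. matrix_J \<alpha> (q + t *\<^sub>R axis l 1) $ j $ k) = (\<lambda>t. matrix_J \<alpha> q $ j $ k + t * ?d)"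
    by blast
  moreover have "((\<lambda>t. matrix_J \<alpha> q $ j $ k + t * ?d) has_real_derivative ?d) (at 0)"
    by (auto intro!: derivative_eq_intros)
  ultimately show ?thesis
    unfolding partial_deriv_def by (simp add: DERIV_imp_deriv)
qed

text \<open>This is the Jacobi identity for coordinate functions. For x, y, z each term vanishes,
  for instance {x, {y, z}} = {x, x}/\<alpha> = 0; repeated indices cancel by antisymmetry; E and B
  contribute nothing because their bracket is constant and they commute with x, y, z. With the
  derivatives replaced by exact differences, all index triples are checked by computation.\<close>

lemma matrix_J_jacobi:
  "(\<Sum>l\<in>UNIV. matrix_J \<alpha> q $ i $ l * partial_deriv l (\<lambda>p. matrix_J \<alpha> p $ j $ k) q
    + matrix_J \<alpha> q $ j $ l * partial_deriv l (\<lambda>p. matrix_J \<alpha> p $ k $ i) q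
    + matrix_J \<alpha> q $ k $ l * partial_deriv l (\<lambda>p. matrix_J \<alpha> p $ i $ j) q) = 0"
proof -
  have "\<forall>i j k. (\<Sum>l\<in>UNIV. matrix_J \<alpha> q $ i $ l * (matrix_J \<alpha> (axis l 1) $ j $ k - matrix_J \<alpha> 0 $ j $ k)
    + matrix_J \<alpha> q $ j $ l * (matrix_J \<alpha> (axis l 1) $ k $ i - matrix_J \<alpha> 0 $ k $ i)
    + matrix_J \<alpha> q $ k $ l * (matrix_J \<alpha> (axis l 1) $ i $ j - matrix_J \<alpha> 0 $ i $ j)) = 0"
    by (simp add: forall_5 sum_5 matrix_J_entries axis_def)
  then show ?thesis
    unfolding partial_deriv_matrix_J by blast
qed

theorem mainTheorem2:
  fixes \<mu> \<alpha> :: real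
  assumes "\<alpha> \<noteq> 0"
  shows "poisson_bracket (matrix_bracket (matrix_J \<alpha>))
    \<and> degenerate_bracket (matrix_bracket (matrix_J \<alpha>))
    \<and> casimir (matrix_bracket (matrix_J \<alpha>)) casimir_F
    \<and> smooth_fun (hamiltonian_H \<mu> \<alpha>)
    \<and> (\<forall>q. system_field \<mu> \<alpha> q = matrix_J \<alpha> q *v gradient (hamiltonian_H \<mu> \<alpha>) q)"
proof (intro conjI allI)
  show "poisson_bracket (matrix_bracket (matrix_J \<alpha>))"
    by (rule poisson_bracket_matrix_bracket[OF matrix_J_smooth matrix_J_antisym matrix_J_jacobi])
  show "degenerate_bracket (matrix_bracket (matrix_J \<alpha>))"
    unfolding degenerate_bracket_def structure_matrix_matrix_bracket
    by (intro allI det_antisym_odd matrix_J_antisym) simp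
  \<comment> \<open>The gradient of F is parallel to (x, y, z), so the cross product
    vanishes.\<close>
  have F_kernel: "matrix_J \<alpha> q *v gradient casimir_F q = 0" for q
    by (simp add: vec_eq_iff forall_5 matrix_vector_mult_def sum_5 gradient_casimir_F
        matrix_J_entries)
  \<comment> \<open>The kernel property concerns the second slot, whereas \<open>casimir\<close>
    puts F in the first; antisymmetry exchanges the slots.\<close>
  have "matrix_bracket (matrix_J \<alpha>) casimir_F g q = 0" for g q
    using matrix_bracket_antisym[of "matrix_J \<alpha>", OF matrix_J_antisym, of casimir_F g q]
    by (simp add: matrix_bracket_def F_kernel)
  moreover have "\<not> casimir_F constant_on UNIV"
  proof
    assume "casimir_F constant_on UNIV"
    then have "casimir_F 0 = casimir_F (axis 1 1)"
      unfolding constant_on_def by (metis UNIV_I)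
    then show False
      by (simp add: casimir_F_def axis_def)
  qed
  ultimately show "casimir (matrix_bracket (matrix_J \<alpha>)) casimir_F"
    by (simp add: casimir_def casimir_F_smooth fun_eq_iff)
  show "smooth_fun (hamiltonian_H \<mu> \<alpha>)"
    by (rule hamiltonian_H_smooth)
  \<comment> \<open>Here \<alpha> \<noteq> 0 enters: 1/\<alpha> cancels the factor \<alpha> in the
    gradient of H, and the entries \<alpha>/\<alpha> of the (E, B) block become 1.\<close>
  show "system_field \<mu> \<alpha> q = matrix_J \<alpha> q *v gradient (hamiltonian_H \<mu> \<alpha>) q" for q
    using assms
    by (simp add: vec_eq_iff forall_5 matrix_vector_mult_def sum_5 gradient_hamiltonian_H
        matrix_J_entries system_field_def Let_def field_simps)
qed

end
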